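(* Let $Q$ be a (unital involutive) quantale with a relational representation $r:Q\to\mathcal Q(X)$ on a set $X$. Then $r$ admits a canonical decomposition into a sum of irreducible representations, one on each connected component of $X$ (the connected components being the equivalence classes of the equivalence relation $r(1)$ on $X$). Furthermore this decomposition is unique up to equivalence of representations (i.e. if $r$ is equivalent to a sum $\coprod_{j\in J}r_j$ of irreducible relational representations, then there is a bijection between $J$ and the set of connected components of $X$ such that each $r_j$ is equivalent to the irreducible representation on the corresponding component), and the irreducible representations in the decomposition are all algebraically irreducible if, and only if, $r$ is deterministic.
   Context: Quantales: a sup-lattice is a partially ordered set with all joins. Here "quantale" means unital involutive quantale: a sup-lattice $Q$ with an associative multiplication $\&$ preserving arbitrary joins in each variable, a unit $e$, and an involution ${}^*$ with $a^{**}=a$, $(a\& b)^*=b^*\& a^*$, $(\bigvee_i a_i)^*=\bigvee_i a_i^*$. The top element is $1$. A homomorphism $h:Q\to Q'$ preserves all joins, multiplication and involution and satisfies $h(e_Q)\ge e_{Q'}$ (equality is not required; if equality holds $h$ is strictly unital). Relational quantale: for a set $X$, $\mathcal Q(X)$ is the quantale of binary relations on $X$ ordered by inclusion, with $R\& S=S\circ R=\{(x,z): \exists y,\ xRy \text{ and } ySz\}$, unit the identity relation $\Delta_X$, and involution the relational converse. A relational representation of $Q$ on $X$ is a homomorphism $r:Q\to\mathcal Q(X)$. Write $x\langle a\rangle y$ for $(x,y)\in r(a)$, and for $Z\subseteq X$ and $a\in Q$ put $Za=\{y\in X: z\langle a\rangle y\text{ for some }z\in Z\}$; this makes the powerset $\mathcal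 P(X)$ a right $Q$-module. The relation $r(1)$ is an equivalence relation on $X$; $x,y$ are connected if $x\langle 1\rangle y$. The representation is deterministic if for all connected $x,y\in X$ there is $a\in Q$ with $\{x\}a=\{y\}$. It is irreducible if $X\neq\emptyset$ and the only $Z\subseteq X$ with $Z1\subseteq Z$ are $\emptyset$ and $X$. It is algebraically irreducible if $X\ne\emptyset$ and $\{\{x\}a: a\in Q\}=\mathcal P(X)$ for every $x\in X$. Two relational representations on $X$ and $X'$ are equivalent if there is an isomorphism $f:\mathcal P(X)\to\mathcal P(X')$ of sup-lattices with $f(Za)=f(Z)a$ for all $Z,a$, such that $Y\cap Z=\emptyset\iff f(Y)\cap f(Z)=\emptyset$. The sum $\coprod_{i\in I}r_i$ of relational representations $r_i:Q\to\mathcal Q(X_i)$ is the relational representation on the disjoint union $\coprod_i X_i$ sending $a$ to the union of the (images in the disjoint union of the) relations $r_i(a)$. *)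

theory Defs
  imports "HOL-Algebra.Complete_Lattice"
begin

record 'a quantale = "'a gorder" +
  qmult :: "'a \<Rightarrow> 'a \<Rightarrow> 'a"  (infixl \<open>\<odot>\<index>\<close> 70)
  qunit :: "'a"  (\<open>\<e>\<index>\<close>)
  qstar :: "'a \<Rightarrow> 'a"  (\<open>_\<star>\<index>\<close> [90] 90)

(* Unital involutive quantales.  A sup-lattice automatically has all meets, so it is a
   complete lattice; only the joins are referred to below. *)
locale quantale = complete_lattice Q for Q (structure) +
  assumes mult_closed: "\<lbrakk>a \<in> carrier Q; b \<in> carrier Q\<rbrakk> \<Longrightarrow> a \<odot> b \<in> carrier Q"
    and unit_closed: "\<e> \<in> carrier Q"
    and star_closed: "a \<in> carrier Q \<Longrightarrow> a\<star> \<in> carrier Q"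
    and mult_assoc: "\<lbrakk>a \<in> carrier Q; b \<in> carrier Q; c \<in> carrier Q\<rbrakk> \<Longrightarrow> (a \<odot> b) \<odot> c = a \<odot> (b \<odot> c)"
    and mult_sup_left: "\<lbrakk>A \<subseteq> carrier Q; b \<in> carrier Q\<rbrakk> \<Longrightarrow> (\<Squnion>A) \<odot> b = \<Squnion>((\<lambda>a. a \<odot> b) ` A)"
    and mult_sup_right: "\<lbrakk>A \<subseteq> carrier Q; b \<in> carrier Q\<rbrakk> \<Longrightarrow> b \<odot> (\<Squnion>A) = \<Squnion>((\<lambda>a. b \<odot> a) ` A)"
    and unit_left: "a \<in> carrier Q \<Longrightarrow> \<e> \<odot> a = a"
    and unit_right: "a \<in> carrier Q \<Longrightarrow> a \<odot> \<e> = a"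
    and star_star: "a \<in> carrier Q \<Longrightarrow> (a\<star>)\<star> = a"
    and star_mult: "\<lbrakk>a \<in> carrier Q; b \<in> carrier Q\<rbrakk> \<Longrightarrow> (a \<odot> b)\<star> = b\<star> \<odot> a\<star>"
    and star_sup: "A \<subseteq> carrier Q \<Longrightarrow> (\<Squnion>A)\<star> = \<Squnion>((\<lambda>a. a\<star>) ` A)"

(* The unit is preserved only laxly. *)
definition quantale_hom ::
  "('a, 'm) quantale_scheme \<Rightarrow> ('b, 'n) quantale_scheme \<Rightarrow> ('a \<Rightarrow> 'b) \<Rightarrow> bool" where
  "quantale_hom Q Q' h \<longleftrightarrow>
     h ` carrier Q \<subseteq> carrier Q' \<and>
     (\<forall>A \<subseteq> carrier Q. h (\<Squnion>\<^bsub>Q\<^esub>A) = \<Squnion>\<^bsub>Q'\<^esub>(h ` A)) \<and>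
     (\<forall>a \<in> carrier Q. \<forall>b \<in> carrier Q. h (a \<odot>\<^bsub>Q\<^esub> b) = h a \<odot>\<^bsub>Q'\<^esub> h b) \<and>
     (\<forall>a \<in> carrier Q. h (a\<star>\<^bsub>Q\<^esub>) = (h a)\<star>\<^bsub>Q'\<^esub>) \<and>
     \<e>\<^bsub>Q'\<^esub> \<sqsubseteq>\<^bsub>Q'\<^esub> h \<e>\<^bsub>Q\<^esub>"

(* The HOL composition R O S is already diagrammatic: first R, then S. *)
definition rel_quantale :: "'x set \<Rightarrow> ('x \<times> 'x) set quantale" where
  "rel_quantale X =
     \<lparr>carrier = Pow (X \<times> X), eq = (=), le = (\<subseteq>),
      qmult = (O), qunit = Id_on X, qstar = converse\<rparr>"

definition relational_rep ::
  "('a, 'm) quantale_scheme \<Rightarrow> 'x set \<Rightarrow> ('a \<Rightarrow> ('x \<times> 'x) set) \<Rightarrow> bool" where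
  "relational_rep Q X r \<longleftrightarrow> quantale_hom Q (rel_quantale X) r"

(* From here on the module action Za on subsets of X is the relational image r a `` Z. *)

definition deterministic_rep ::
  "('a, 'm) quantale_scheme \<Rightarrow> 'x set \<Rightarrow> ('a \<Rightarrow> ('x \<times> 'x) set) \<Rightarrow> bool" where
  "deterministic_rep Q X r \<longleftrightarrow>
     (\<forall>x \<in> X. \<forall>y \<in> X. (x, y) \<in> r \<top>\<^bsub>Q\<^esub> \<longrightarrow> (\<exists>a \<in> carrier Q. r a `` {x} = {y}))"

definition irreducible_rep ::
  "('a, 'm) quantale_scheme \<Rightarrow> 'x set \<Rightarrow> ('a \<Rightarrow> ('x \<times> 'x) set) \<Rightarrow> bool" where
  "irreducible_rep Q X r \<longleftrightarrow>
     X \<noteq> {} \<and> (\<forall>Z \<subseteq> X. r \<top>\<^bsub>Q\<^esub> `` Z \<subseteq> Z \<longrightarrow> Z = {} \<or> Z = X)"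

definition alg_irreducible_rep ::
  "('a, 'm) quantale_scheme \<Rightarrow> 'x set \<Rightarrow> ('a \<Rightarrow> ('x \<times> 'x) set) \<Rightarrow> bool" where
  "alg_irreducible_rep Q X r \<longleftrightarrow>
     X \<noteq> {} \<and> (\<forall>x \<in> X. {r a `` {x} | a. a \<in> carrier Q} = Pow X)"

definition powerset_iso :: "'x set \<Rightarrow> 'y set \<Rightarrow> ('x set \<Rightarrow> 'y set) \<Rightarrow> bool" where
  "powerset_iso X Y f \<longleftrightarrow>
     bij_betw f (Pow X) (Pow Y) \<and> (\<forall>\<Z> \<subseteq> Pow X. f (\<Union>\<Z>) = \<Union>(f ` \<Z>))"

definition rep_equivalence ::
  "('a, 'm) quantale_scheme \<Rightarrow> 'x set \<Rightarrow> ('a \<Rightarrow> ('x \<times> 'x) set) \<Rightarrow>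
   'y set \<Rightarrow> ('a \<Rightarrow> ('y \<times> 'y) set) \<Rightarrow> ('x set \<Rightarrow> 'y set) \<Rightarrow> bool" where
  "rep_equivalence Q X r Y s f \<longleftrightarrow>
     powerset_iso X Y f \<and>
     (\<forall>Z \<subseteq> X. \<forall>a \<in> carrier Q. f (r a `` Z) = s a `` f Z) \<and>
     (\<forall>W \<subseteq> X. \<forall>Z \<subseteq> X. W \<inter> Z = {} \<longleftrightarrow> f W \<inter> f Z = {})"

definition equivalent_reps ::
  "('a, 'm) quantale_scheme \<Rightarrow> 'x set \<Rightarrow> ('a \<Rightarrow> ('x \<times> 'x) set) \<Rightarrow>
   'y set \<Rightarrow> ('a \<Rightarrow> ('y \<times> 'y) set) \<Rightarrow> bool" where
  "equivalent_reps Q X r Y s \<longleftrightarrow> (\<exists>f. rep_equivalence Q X r Y s f)"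

(* The sum of the representations s j on the sets Y j lives on the disjoint union Sigma J Y. *)
definition rep_sum ::
  "'j set \<Rightarrow> ('j \<Rightarrow> 'a \<Rightarrow> ('y \<times> 'y) set) \<Rightarrow> 'a \<Rightarrow> (('j \<times> 'y) \<times> ('j \<times> 'y)) set" where
  "rep_sum J s a = (\<Union>j \<in> J. {((j, x), (j, y)) | x y. (x, y) \<in> s j a})"

definition rep_components ::
  "('a, 'm) quantale_scheme \<Rightarrow> 'x set \<Rightarrow> ('a \<Rightarrow> ('x \<times> 'x) set) \<Rightarrow> 'x set set" where
  "rep_components Q X r = X // r \<top>\<^bsub>Q\<^esub>"

definition restrict_rep ::
  "('a \<Rightarrow> ('x \<times> 'x) set) \<Rightarrow> 'x set \<Rightarrow> 'a \<Rightarrow> ('x \<times> 'x) set" where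
  "restrict_rep r C a = r a \<inter> C \<times> C"

lemma rel_quantale_complete_lattice: "complete_lattice (rel_quantale X)"
proof -
  interpret partial_order "rel_quantale X"
    by unfold_locales (auto simp: rel_quantale_def)
  show ?thesis
  proof (rule complete_latticeI)
    fix A assume "A \<subseteq> carrier (rel_quantale X)"
    then have "least (rel_quantale X) (\<Union>A) (Upper (rel_quantale X) A)"
      unfolding rel_quantale_def least_def Upper_def by simp blast
    then show "\<exists>s. least (rel_quantale X) s (Upper (rel_quantale X) A)" ..
  next
    fix A assume "A \<subseteq> carrier (rel_quantale X)"
    then have "greatest (rel_quantale X) (X \<times> X \<inter> \<Inter>A) (Lower (rel_quantale X) A)"
      unfolding rel_quantale_def greatest_def Lower_def by simp blast
    then show "\<exists>i. greatest (rel_quantale X) i (Lower (rel_quantale X) A)" ..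
  qed
qed

lemma rel_quantale_sup:
  assumes "A \<subseteq> Pow (X \<times> X)"
  shows "\<Squnion>\<^bsub>rel_quantale X\<^esub>A = \<Union>A"
proof -
  interpret complete_lattice "rel_quantale X" by (rule rel_quantale_complete_lattice)
  have A: "A \<subseteq> carrier (rel_quantale X)" using assms by (simp add: rel_quantale_def)
  then have "least (rel_quantale X) (\<Union>A) (Upper (rel_quantale X) A)"
    unfolding rel_quantale_def least_def Upper_def by simp blast
  with A show ?thesis
    by (intro supI[where P = "\<lambda>s. s = \<Union>A"]) (rule least_unique)
qed

lemma rel_quantale_quantale: "quantale (rel_quantale X)"
proof -
  interpret complete_lattice "rel_quantale X" by (rule rel_quantale_complete_lattice)
  have im: "f ` A \<subseteq> Pow (X \<times> X)" if "\<And>R. R \<in> A \<Longrightarrow> f R \<subseteq> X \<times> X"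
    for f :: "('a \<times> 'a) set \<Rightarrow> ('a \<times> 'a) set" and A using that by blast
  have s: "\<Squnion>\<^bsub>rel_quantale X\<^esub>A = \<Union>A" if "A \<subseteq> Pow (X \<times> X)" for A
    by (rule rel_quantale_sup[OF that])
  have c: "carrier (rel_quantale X) = Pow (X \<times> X)"
    "\<And>R S. R \<odot>\<^bsub>rel_quantale X\<^esub> S = R O S" "\<And>R. R\<star>\<^bsub>rel_quantale X\<^esub> = R\<inverse>" "\<e>\<^bsub>rel_quantale X\<^esub> = Id_on X"
    by (simp_all add: rel_quantale_def)
  show ?thesis
  proof (unfold_locales, unfold c)
    fix A b assume A: "A \<subseteq> Pow (X \<times> X)" and b: "b \<in> Pow (X \<times> X)"
    have "(\<lambda>a. a O b) ` A \<subseteq> Pow (X \<times> X)" "(\<lambda>a. b O a) ` A \<subseteq> Pow (X \<times> X)"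
      using A b by blast+
    then show "\<Squnion>\<^bsub>rel_quantale X\<^esub>A O b = \<Squnion>\<^bsub>rel_quantale X\<^esub>((\<lambda>a. a O b) ` A)"
      and "b O \<Squnion>\<^bsub>rel_quantale X\<^esub>A = \<Squnion>\<^bsub>rel_quantale X\<^esub>((\<lambda>a. b O a) ` A)"
      using A by (auto simp: s)
  next
    fix A assume A: "A \<subseteq> Pow (X \<times> X)"
    have "converse ` A \<subseteq> Pow (X \<times> X)" using A by blast
    then show "(\<Squnion>\<^bsub>rel_quantale X\<^esub>A)\<inverse> = \<Squnion>\<^bsub>rel_quantale X\<^esub>(converse ` A)"
      using A by (auto simp: s)
  qed auto
qed

lemma relational_rep_iff:
  "relational_rep Q X r \<longleftrightarrow>
     (\<forall>a \<in> carrier Q. r a \<subseteq> X \<times> X) \<and>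
     (\<forall>A \<subseteq> carrier Q. r (\<Squnion>\<^bsub>Q\<^esub>A) = \<Union>(r ` A)) \<and>
     (\<forall>a \<in> carrier Q. \<forall>b \<in> carrier Q. r (a \<odot>\<^bsub>Q\<^esub> b) = r a O r b) \<and>
     (\<forall>a \<in> carrier Q. r (a\<star>\<^bsub>Q\<^esub>) = (r a)\<inverse>) \<and>
     Id_on X \<subseteq> r \<e>\<^bsub>Q\<^esub>"
proof -
  have sup: "\<Squnion>\<^bsub>rel_quantale X\<^esub>(r ` A) = \<Union>(r ` A)"
    if "\<forall>a \<in> carrier Q. r a \<subseteq> X \<times> X" "A \<subseteq> carrier Q" for A
    using that by (intro rel_quantale_sup) blast
  have c: "carrier (rel_quantale X) = Pow (X \<times> X)"
    "\<And>R S. R \<odot>\<^bsub>rel_quantale X\<^esub> S = R O S" "\<And>R. R\<star>\<^bsub>rel_quantale X\<^esub> = R\<inverse>"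
    "\<e>\<^bsub>rel_quantale X\<^esub> = Id_on X" "\<And>R S. R \<sqsubseteq>\<^bsub>rel_quantale X\<^esub> S \<longleftrightarrow> R \<subseteq> S"
    "r ` carrier Q \<subseteq> Pow (X \<times> X) \<longleftrightarrow> (\<forall>a \<in> carrier Q. r a \<subseteq> X \<times> X)"
    by (simp_all add: rel_quantale_def image_subset_iff)
  show ?thesis
    unfolding relational_rep_def quantale_hom_def c
    by (intro conj_cong refl all_cong) (simp add: sup)
qed

lemma equiv_top:
  assumes "quantale Q" "relational_rep Q X r"
  shows "equiv X (r \<top>\<^bsub>Q\<^esub>)"
proof -
  interpret quantale Q by fact
  have rX: "r a \<subseteq> X \<times> X" and rm: "r (a \<odot>\<^bsub>Q\<^esub> a) = r a O r a" and rs: "r (a\<star>\<^bsub>Q\<^esub>) = (r a)\<inverse>"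
    if "a \<in> carrier Q" for a
    using assms(2) that by (simp_all add: relational_rep_iff)
  have rS: "r (\<Squnion>\<^bsub>Q\<^esub>carrier Q) = \<Union>(r ` carrier Q)" and re: "Id_on X \<subseteq> r \<e>\<^bsub>Q\<^esub>"
    using assms(2) by (simp_all add: relational_rep_iff)
  have "\<Squnion>\<^bsub>Q\<^esub>carrier Q = \<top>\<^bsub>Q\<^esub>"
    using weak_sup_carrier unfolding eq_is_equal .
  then have mono: "r a \<subseteq> r \<top>\<^bsub>Q\<^esub>" if "a \<in> carrier Q" for a
    using rS that by auto
  have t: "\<top>\<^bsub>Q\<^esub> \<in> carrier Q" by (rule top_closed)
  have sub: "r \<top>\<^bsub>Q\<^esub> \<subseteq> X \<times> X" by (rule rX[OF t])
  have 1: "r \<top>\<^bsub>Q\<^esub> O r \<top>\<^bsub>Q\<^esub> \<subseteq> r \<top>\<^bsub>Q\<^esub>" and 2: "(r \<top>\<^bsub>Q\<^esub>)\<inverse> \<subseteq> r \<top>\<^bsub>Q\<^esub>"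
    using mono[OF mult_closed[OF t t]] mono[OF star_closed[OF t]] unfolding rm[OF t] rs[OF t] .
  have 3: "Id_on X \<subseteq> r \<top>\<^bsub>Q\<^esub>" using re mono[OF unit_closed] by (rule subset_trans)
  have "refl_on X (r \<top>\<^bsub>Q\<^esub>)" using 3 unfolding refl_on_def by blast
  moreover have "sym (r \<top>\<^bsub>Q\<^esub>)" using 2 unfolding sym_def by blast
  moreover have "trans (r \<top>\<^bsub>Q\<^esub>)" using 1 unfolding trans_def by blast
  ultimately show ?thesis using sub by (simp add: equiv_def)
qed

lemma relational_rep_sum:
  assumes "\<And>j. j \<in> J \<Longrightarrow> relational_rep Q (Y j) (s j)"
  shows "relational_rep Q (Sigma J Y) (rep_sum J s)"
proof -
  have s: "s j a \<subseteq> Y j \<times> Y j" "s j (a \<odot>\<^bsub>Q\<^esub> b) = s j a O s j b" "s j (a\<star>\<^bsub>Q\<^esub>) = (s j a)\<inverse>"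
    if "j \<in> J" "a \<in> carrier Q" "b \<in> carrier Q" for j a b
    using assms[OF that(1)] that(2,3) unfolding relational_rep_iff by blast+
  have u: "s j (\<Squnion>\<^bsub>Q\<^esub>A) = \<Union>(s j ` A)" "Id_on (Y j) \<subseteq> s j \<e>\<^bsub>Q\<^esub>"
    if "j \<in> J" "A \<subseteq> carrier Q" for j A
    using assms[OF that(1)] that(2) unfolding relational_rep_iff by blast+
  show ?thesis
    unfolding relational_rep_iff
  proof (intro conjI ballI allI impI)
    fix a assume a: "a \<in> carrier Q"
    show "rep_sum J s a \<subseteq> Sigma J Y \<times> Sigma J Y"
      using s(1)[OF _ a a] unfolding rep_sum_def by blast
    show "rep_sum J s (a\<star>\<^bsub>Q\<^esub>) = (rep_sum J s a)\<inverse>"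
      using s(3)[OF _ a a] by (auto simp: rep_sum_def)
    fix b assume b: "b \<in> carrier Q"
    show "rep_sum J s (a \<odot>\<^bsub>Q\<^esub> b) = rep_sum J s a O rep_sum J s b"
      using s(2)[OF _ a b] by (auto simp: rep_sum_def)
  next
    fix A assume A: "A \<subseteq> carrier Q"
    show "rep_sum J s (\<Squnion>\<^bsub>Q\<^esub>A) = \<Union>(rep_sum J s ` A)"
      using u(1)[OF _ A] by (auto simp: rep_sum_def)
  next
    show "Id_on (Sigma J Y) \<subseteq> rep_sum J s \<e>\<^bsub>Q\<^esub>"
      using u(2)[OF _ empty_subsetI] unfolding rep_sum_def by blast
  qed
qed

end

theory Submission
  imports Defs
begin

text \<open>
  A sup-lattice isomorphism of powersets maps atoms to atoms, so an equivalence of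
  representations is the direct image along a bijection of the underlying sets that respects all
  the relations. Every \<open>r a\<close> is contained in the equivalence relation \<open>r \<top>\<close>, hence \<open>r\<close> is the
  disjoint union of its restrictions to the classes. Irreducibility means that \<open>r \<top>\<close> is the total
  relation, so the summands of any decomposition into irreducibles must be carried to
  the classes of \<open>r \<top>\<close>.
\<close>

section \<open>Equivalences as bijections of the underlying sets\<close>

text \<open>The map \<open>g\<close> is read off from the values of \<open>f\<close> on singletons;
  as every set is the union of its singletons, preservation of unions then determines
  \<open>f\<close> everywhere.\<close>

lemma powerset_iso_imageE:
  assumes "powerset_iso X Y f"
  obtains g where "bij_betw g X Y" "\<And>Z. Z \<subseteq> X \<Longrightarrow> f Z = g ` Z"
proof -
  have inj: "inj_on f (Pow X)" and im: "f ` Pow X = Pow Y"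
    using assms by (auto simp: powerset_iso_def bij_betw_def)
  have Un: "f (\<Union>\<Z>) = \<Union>(f ` \<Z>)" if "\<Z> \<subseteq> Pow X" for \<Z>
    using assms that by (simp add: powerset_iso_def)
  have f0: "f {} = {}" using Un[of "{}"] by simp
  have "\<exists>y. f {x} = {y}" if x: "x \<in> X" for x
  proof -
    have "f {x} \<noteq> f {}" using inj_onD[OF inj, of "{x}" "{}"] x by auto
    then obtain y where y: "y \<in> f {x}" using f0 by auto
    have "f {x} \<in> Pow Y" using im x by blast
    with y have "{y} \<in> f ` Pow X" unfolding im by blast
    then obtain W where W: "W \<subseteq> X" "f W = {y}" by auto
    \<comment> \<open>Here \<open>W\<close> is the preimage of an atom \<open>{y}\<close> below
      \<open>f {x}\<close>. Joining it to \<open>{x}\<close> does not change the value of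
      \<open>f\<close>, so injectivity puts the nonempty set \<open>W\<close> inside
      \<open>{x}\<close>.\<close>
    have "f ({x} \<union> W) = f {x}" using Un[of "{{x}, W}"] x W y by auto
    then have "{x} \<union> W = {x}" using inj_onD[OF inj, of "{x} \<union> W" "{x}"] x W by auto
    moreover have "W \<noteq> {}" using W f0 by auto
    ultimately have "W = {x}" by auto
    with W show ?thesis by blast
  qed
  then obtain g where g: "\<And>x. x \<in> X \<Longrightarrow> f {x} = {g x}" by metis
  have fg: "f Z = g ` Z" if Z: "Z \<subseteq> X" for Z
  proof -
    have "f Z = f (\<Union>((\<lambda>x. {x}) ` Z))" by simp
    also have "\<dots> = \<Union>(f ` (\<lambda>x. {x}) ` Z)" using Z by (intro Un) auto
    also have "\<dots> = g ` Z" using g Z by auto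
    finally show ?thesis .
  qed
  have "inj_on g X"
  proof (rule inj_onI)
    fix x y assume "x \<in> X" "y \<in> X" "g x = g y"
    then show "x = y" using g inj_onD[OF inj, of "{x}" "{y}"] by auto
  qed
  moreover have "g ` X = Y"
  proof
    have "f X \<in> Pow Y" using im by blast
    then show "g ` X \<subseteq> Y" using fg[of X] by auto
    have "Y \<in> f ` Pow X" unfolding im by blast
    then show "Y \<subseteq> g ` X" using fg by blast
  qed
  ultimately show thesis using that fg by (simp add: bij_betw_def)
qed

text \<open>The module condition at \<open>{x}\<close> compares the successors of \<open>x\<close>
  under \<open>r a\<close> with those of \<open>g x\<close> under \<open>s a\<close>. Injectivity of
  \<open>g\<close> turns this equality of sets into an equivalence on pairs.\<close>

lemma rep_equivalence_bijE:
  assumes "rep_equivalence Q X r Y s f"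
    and "\<And>a. a \<in> carrier Q \<Longrightarrow> r a \<subseteq> X \<times> X"
  obtains g where "bij_betw g X Y"
    "\<And>a x y. \<lbrakk>a \<in> carrier Q; x \<in> X; y \<in> X\<rbrakk> \<Longrightarrow> (x, y) \<in> r a \<longleftrightarrow> (g x, g y) \<in> s a"
proof -
  obtain g where g: "bij_betw g X Y" "\<And>Z. Z \<subseteq> X \<Longrightarrow> f Z = g ` Z"
    using assms(1) powerset_iso_imageE unfolding rep_equivalence_def by metis
  have "(x, y) \<in> r a \<longleftrightarrow> (g x, g y) \<in> s a"
    if a: "a \<in> carrier Q" and x: "x \<in> X" and y: "y \<in> X" for a x y
  proof -
    have sub: "r a `` {x} \<subseteq> X" using assms(2)[OF a] by blast
    have "f (r a `` {x}) = s a `` f {x}"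
      using assms(1) a x unfolding rep_equivalence_def by simp
    then have "g ` (r a `` {x}) = s a `` {g x}" using g(2) sub x by simp
    then have "(g x, g y) \<in> s a \<longleftrightarrow> g y \<in> g ` (r a `` {x})" by simp
    also have "\<dots> \<longleftrightarrow> y \<in> r a `` {x}"
      using inj_on_image_mem_iff[OF bij_betw_imp_inj_on[OF g(1)] y sub] .
    finally show ?thesis by simp
  qed
  with g(1) show thesis by (rule that)
qed

text \<open>Converse of \<open>rep_equivalence_bijE\<close>, through which every equivalence below
  is constructed.\<close>

lemma rep_equivalence_image:
  assumes g: "bij_betw g X Y"
    and r: "\<And>a. a \<in> carrier Q \<Longrightarrow> r a \<subseteq> X \<times> X"
    and s: "\<And>a. a \<in> carrier Q \<Longrightarrow> s a \<subseteq> Y \<times> Y"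
    and rs: "\<And>a x y. \<lbrakk>a \<in> carrier Q; x \<in> X; y \<in> X\<rbrakk> \<Longrightarrow> (x, y) \<in> r a \<longleftrightarrow> (g x, g y) \<in> s a"
  shows "rep_equivalence Q X r Y s (\<lambda>Z. g ` Z)"
  unfolding rep_equivalence_def powerset_iso_def
proof (intro conjI allI impI ballI)
  show "bij_betw (\<lambda>Z. g ` Z) (Pow X) (Pow Y)" by (rule bij_betw_Pow[OF g])
next
  fix \<Z> assume "\<Z> \<subseteq> Pow X"
  show "g ` \<Union>\<Z> = \<Union>((\<lambda>Z. g ` Z) ` \<Z>)" by blast
next
  fix Z a assume Z: "Z \<subseteq> X" and a: "a \<in> carrier Q"
  have gX: "g ` X = Y" using g by (simp add: bij_betw_def)
  show "g ` (r a `` Z) = s a `` (g ` Z)"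
  proof
    show "g ` (r a `` Z) \<subseteq> s a `` (g ` Z)" using r[OF a] rs[OF a] by blast
    show "s a `` (g ` Z) \<subseteq> g ` (r a `` Z)"
    proof
      fix v assume "v \<in> s a `` (g ` Z)"
      then obtain x where x: "x \<in> Z" "(g x, v) \<in> s a" by blast
      \<comment> \<open>Since \<open>s a\<close> stays within \<open>Y\<close>, the successor
        \<open>v\<close> has a preimage under \<open>g\<close>, to which \<open>rs\<close>
        applies.\<close>
      then obtain y where y: "y \<in> X" "v = g y" using s[OF a] gX by blast
      then show "v \<in> g ` (r a `` Z)" using x Z rs[OF a, of x y] by blast
    qed
  qed
next
  fix W Z assume "W \<subseteq> X" "Z \<subseteq> X"
  then have "g ` (W \<inter> Z) = g ` W \<inter> g ` Z"
    using g by (intro inj_on_image_Int) (auto simp: bij_betw_def)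
  then show "W \<inter> Z = {} \<longleftrightarrow> g ` W \<inter> g ` Z = {}" by (metis image_is_empty)
qed

text \<open>The inverse of the underlying bijection respects the relations in the other
  direction.\<close>

lemma equivalent_reps_sym:
  assumes r: "\<And>a. a \<in> carrier Q \<Longrightarrow> r a \<subseteq> X \<times> X"
    and s: "\<And>a. a \<in> carrier Q \<Longrightarrow> s a \<subseteq> Y \<times> Y"
    and "equivalent_reps Q X r Y s"
  shows "equivalent_reps Q Y s X r"
proof -
  obtain f where f: "rep_equivalence Q X r Y s f" using assms(3) unfolding equivalent_reps_def ..
  obtain g where g: "bij_betw g X Y"
    "\<And>a x y. \<lbrakk>a \<in> carrier Q; x \<in> X; y \<in> X\<rbrakk> \<Longrightarrow> (x, y) \<in> r a \<longleftrightarrow> (g x, g y) \<in> s a"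
    using rep_equivalence_bijE[OF f r] by metis
  have "rep_equivalence Q Y s X r (\<lambda>Z. inv_into X g ` Z)"
  proof (rule rep_equivalence_image[OF bij_betw_inv_into[OF g(1)] s r])
    fix a x y assume "a \<in> carrier Q" "x \<in> Y" "y \<in> Y"
    then show "(x, y) \<in> s a \<longleftrightarrow> (inv_into X g x, inv_into X g y) \<in> r a"
      using g(2)[of a "inv_into X g x" "inv_into X g y"] g(1)
      by (simp add: bij_betw_inv_into_right bij_betw_imp_surj_on inv_into_into)
  qed
  then show ?thesis unfolding equivalent_reps_def by blast
qed

section \<open>Restriction of a representation to its components\<close>

text \<open>As a locale, so that facts about \<open>r\<close> can also be instantiated at each
  summand \<open>s j\<close> in the uniqueness proof.\<close>

locale relational_representation = quantale Q for Q (structure) +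
  fixes X :: "'x set" and r :: "'a \<Rightarrow> ('x \<times> 'x) set"
  assumes rep: "relational_rep Q X r"
begin

lemma rep_closed: "a \<in> carrier Q \<Longrightarrow> r a \<subseteq> X \<times> X"
  and rep_sup: "A \<subseteq> carrier Q \<Longrightarrow> r (\<Squnion>A) = \<Union>(r ` A)"
  and rep_mult: "\<lbrakk>a \<in> carrier Q; b \<in> carrier Q\<rbrakk> \<Longrightarrow> r (a \<odot> b) = r a O r b"
  and rep_star: "a \<in> carrier Q \<Longrightarrow> r (a\<star>) = (r a)\<inverse>"
  and rep_unit: "Id_on X \<subseteq> r \<e>"
  using rep by (simp_all add: relational_rep_iff)

text \<open>The top is the join of the whole carrier and \<open>r\<close> preserves joins, so
  \<open>r \<top>\<close> is the union of all \<open>r a\<close>.\<close>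

lemma rep_le_top:
  assumes "a \<in> carrier Q"
  shows "r a \<subseteq> r \<top>"
proof -
  have "\<Squnion>carrier Q = \<top>" using weak_sup_carrier unfolding eq_is_equal .
  then show ?thesis using assms rep_sup[of "carrier Q"] by auto
qed

lemma equiv_rep_top: "equiv X (r \<top>)"
  using quantale_axioms rep by (rule equiv_top)

lemma rep_components_subset: "C \<in> rep_components Q X r \<Longrightarrow> C \<subseteq> X"
  unfolding rep_components_def by (rule in_quotient_imp_subset[OF equiv_rep_top])

text \<open>As \<open>r a\<close> lies below the equivalence relation \<open>r \<top>\<close>, it
  never relates points of different classes.\<close>

lemma rep_components_closed:
  assumes "C \<in> rep_components Q X r" "a \<in> carrier Q" "(x, y) \<in> r a"
  shows "x \<in> C \<longleftrightarrow> y \<in> C"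
proof -
  have "(x, y) \<in> r \<top>" using assms(2,3) rep_le_top by blast
  moreover from this have "(y, x) \<in> r \<top>" using equiv_rep_top by (meson equivE symE)
  ultimately show ?thesis
    using assms(1) in_quotient_imp_closed[OF equiv_rep_top] unfolding rep_components_def by blast
qed

lemma rep_components_eq_Image:
  assumes "C \<in> rep_components Q X r" "x \<in> C"
  shows "C = r \<top> `` {x}"
proof -
  obtain y where C: "C = r \<top> `` {y}"
    using assms(1) unfolding rep_components_def by (rule quotientE)
  then have "(y, x) \<in> r \<top>" using assms(2) by simp
  then show ?thesis unfolding C by (rule equiv_class_eq[OF equiv_rep_top])
qed

lemma restrict_rep_Image:
  assumes "C \<in> rep_components Q X r" "a \<in> carrier Q" "x \<in> C"
  shows "restrict_rep r C a `` {x} = r a `` {x}"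
  using rep_components_closed[OF assms(1,2)] assms(3) by (auto simp: restrict_rep_def)

text \<open>Multiplicativity is where the choice of \<open>C\<close> as a component matters: the
  middle point of a composite starting in \<open>C\<close> lies in \<open>C\<close> again, by
  \<open>rep_components_closed\<close>.\<close>

lemma relational_rep_restrict:
  assumes C: "C \<in> rep_components Q X r"
  shows "relational_rep Q C (restrict_rep r C)"
  unfolding relational_rep_iff restrict_rep_def
proof (intro conjI ballI allI impI)
  fix a assume a: "a \<in> carrier Q"
  show "r a \<inter> C \<times> C \<subseteq> C \<times> C" by blast
  show "r (a\<star>) \<inter> C \<times> C = (r a \<inter> C \<times> C)\<inverse>" using rep_star[OF a] by blast
  fix b assume b: "b \<in> carrier Q"
  show "r (a \<odot> b) \<inter> C \<times> C = (r a \<inter> C \<times> C) O (r b \<inter> C \<times> C)"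
    using rep_mult[OF a b] rep_components_closed[OF C a] by blast
next
  fix A assume "A \<subseteq> carrier Q"
  then show "r (\<Squnion>A) \<inter> C \<times> C = (\<Union>a\<in>A. r a \<inter> C \<times> C)" using rep_sup by blast
next
  show "Id_on C \<subseteq> r \<e> \<inter> C \<times> C" using rep_unit rep_components_subset[OF C] by blast
qed

text \<open>One point suffices: its image under \<open>r \<top>\<close> is its whole class, so a
  nonempty invariant subset of \<open>C\<close> is all of \<open>C\<close>.\<close>

lemma irreducible_rep_restrict:
  assumes C: "C \<in> rep_components Q X r"
  shows "irreducible_rep Q C (restrict_rep r C)"
  unfolding irreducible_rep_def
proof (intro conjI allI impI)
  show "C \<noteq> {}"
    using C in_quotient_imp_non_empty[OF equiv_rep_top] unfolding rep_components_def by blast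
  fix Z assume Z: "Z \<subseteq> C" "restrict_rep r C \<top> `` Z \<subseteq> Z"
  show "Z = {} \<or> Z = C"
  proof (cases "Z = {}")
    case False
    then obtain x where x: "x \<in> Z" by blast
    then have "C = restrict_rep r C \<top> `` {x}"
      using restrict_rep_Image[OF C top_closed] rep_components_eq_Image[OF C] Z by auto
    then show ?thesis using Z x by blast
  qed simp
qed

section \<open>The canonical decomposition\<close>

text \<open>The underlying bijection tags each point with its class. Points related by some
  \<open>r a\<close> carry the same tag, so the pair survives in a single summand.\<close>

lemma rep_equivalence_components:
  "rep_equivalence Q X r
     (SIGMA C : rep_components Q X r. C) (rep_sum (rep_components Q X r) (restrict_rep r))
     (\<lambda>Z. (\<lambda>x. (r \<top> `` {x}, x)) ` Z)"
proof (rule rep_equivalence_image)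
  have self: "x \<in> r \<top> `` {x}" if "x \<in> X" for x
    using that equiv_class_self[OF equiv_rep_top] by blast
  have cls: "r \<top> `` {x} \<in> rep_components Q X r" if "x \<in> X" for x
    using that unfolding rep_components_def by (rule quotientI)
  show "bij_betw (\<lambda>x. (r \<top> `` {x}, x)) X (SIGMA C : rep_components Q X r. C)"
    unfolding bij_betw_def
  proof
    show "inj_on (\<lambda>x. (r \<top> `` {x}, x)) X" by (rule inj_onI) simp
    show "(\<lambda>x. (r \<top> `` {x}, x)) ` X = (SIGMA C : rep_components Q X r. C)"
      using self cls rep_components_subset rep_components_eq_Image by fastforce
  qed
  show "r a \<subseteq> X \<times> X" if "a \<in> carrier Q" for a using that by (rule rep_closed)
  show "rep_sum (rep_components Q X r) (restrict_rep r) a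
      \<subseteq> (SIGMA C : rep_components Q X r. C) \<times> (SIGMA C : rep_components Q X r. C)"
    if "a \<in> carrier Q" for a
    unfolding rep_sum_def restrict_rep_def by blast
  show "(x, y) \<in> r a \<longleftrightarrow>
      ((r \<top> `` {x}, x), (r \<top> `` {y}, y)) \<in> rep_sum (rep_components Q X r) (restrict_rep r) a"
    if a: "a \<in> carrier Q" and x: "x \<in> X" and y: "y \<in> X" for a x y
  proof
    assume xy: "(x, y) \<in> r a"
    then have "(x, y) \<in> r \<top>" using rep_le_top[OF a] by blast
    then have eq: "r \<top> `` {x} = r \<top> `` {y}" by (rule equiv_class_eq[OF equiv_rep_top])
    then have "(x, y) \<in> restrict_rep r (r \<top> `` {y}) a"
      using xy self[OF x] self[OF y] unfolding restrict_rep_def by blast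
    then show "((r \<top> `` {x}, x), (r \<top> `` {y}, y)) \<in> rep_sum (rep_components Q X r) (restrict_rep r) a"
      using cls[OF y] eq unfolding rep_sum_def by blast
  next
    assume "((r \<top> `` {x}, x), (r \<top> `` {y}, y)) \<in> rep_sum (rep_components Q X r) (restrict_rep r) a"
    then show "(x, y) \<in> r a" unfolding rep_sum_def restrict_rep_def by blast
  qed
qed

section \<open>Uniqueness of the decomposition\<close>

text \<open>The image of \<open>{x}\<close> under \<open>r \<top>\<close> is invariant by
  transitivity and nonempty by reflexivity, so irreducibility makes it all of
  \<open>X\<close>.\<close>

lemma irreducible_rep_top:
  assumes "irreducible_rep Q X r"
  shows "r \<top> = X \<times> X"
proof
  show "r \<top> \<subseteq> X \<times> X" by (rule rep_closed[OF top_closed])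
  show "X \<times> X \<subseteq> r \<top>"
  proof safe
    fix x y assume x: "x \<in> X" and y: "y \<in> X"
    have "r \<top> `` (r \<top> `` {x}) \<subseteq> r \<top> `` {x}"
      using equiv_rep_top unfolding equiv_def trans_def by blast
    moreover have "x \<in> r \<top> `` {x}" "r \<top> `` {x} \<subseteq> X"
      using equiv_class_self[OF equiv_rep_top x] rep_closed[OF top_closed] by auto
    ultimately have "r \<top> `` {x} = X"
      using assms unfolding irreducible_rep_def by blast
    then show "(x, y) \<in> r \<top>" using y by blast
  qed
qed

lemma irreducible_decomposition_unique:
  assumes irr: "\<And>j. j \<in> J \<Longrightarrow> relational_rep Q (Y j) (s j) \<and> irreducible_rep Q (Y j) (s j)"
    and eqv: "equivalent_reps Q X r (Sigma J Y) (rep_sum J s)"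
  shows "\<exists>h. bij_betw h J (rep_components Q X r) \<and>
           (\<forall>j \<in> J. equivalent_reps Q (Y j) (s j) (h j) (restrict_rep r (h j)))"
proof -
  have sum_closed: "rep_sum J s a \<subseteq> Sigma J Y \<times> Sigma J Y" if "a \<in> carrier Q" for a
    using relational_rep_sum[of J Q Y s] irr that unfolding relational_rep_iff by blast
  have s_closed: "s j a \<subseteq> Y j \<times> Y j" if "j \<in> J" "a \<in> carrier Q" for j a
    using irr[OF that(1)] that(2) unfolding relational_rep_iff by blast
  have s_top: "s j \<top> = Y j \<times> Y j" if "j \<in> J" for j
  proof -
    interpret s: relational_representation Q "Y j" "s j"
      using irr[OF that] by unfold_locales blast
    show ?thesis using irr[OF that] by (intro s.irreducible_rep_top) simp
  qed
  \<comment> \<open>The equivalence is reversed to get a bijection out of the sum, under which each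
    summand has an image in \<open>X\<close>.\<close>
  have "equivalent_reps Q (Sigma J Y) (rep_sum J s) X r"
    using rep_closed sum_closed eqv by (rule equivalent_reps_sym)
  then obtain f where f: "rep_equivalence Q (Sigma J Y) (rep_sum J s) X r f"
    unfolding equivalent_reps_def ..
  obtain g where g: "bij_betw g (Sigma J Y) X"
    and gr: "\<And>a p q. \<lbrakk>a \<in> carrier Q; p \<in> Sigma J Y; q \<in> Sigma J Y\<rbrakk> \<Longrightarrow>
        (p, q) \<in> rep_sum J s a \<longleftrightarrow> (g p, g q) \<in> r a"
    using rep_equivalence_bijE[OF f sum_closed] by metis
  have inj: "inj_on g (Sigma J Y)" and gX: "g ` Sigma J Y = X"
    using g by (simp_all add: bij_betw_def)
  define h where "h j = (\<lambda>y. g (j, y)) ` Y j" for j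
  \<comment> \<open>An empty summand would have an empty image, which is no class. The points
    obtained here also separate the sets \<open>h j\<close> for different indices.\<close>
  have ne: "Y j \<noteq> {}" if "j \<in> J" for j
    using irr[OF that] by (simp add: irreducible_rep_def)
  \<comment> \<open>In the sum, distinct summands are unrelated and each \<open>s j \<top>\<close>
    is total, so connectedness is equality of indices. Hence the images of the summands are exactly
    the classes.\<close>
  have g_top: "(g (j, y), g (k, z)) \<in> r \<top> \<longleftrightarrow> j = k"
    if "j \<in> J" "y \<in> Y j" "k \<in> J" "z \<in> Y k" for j y k z
    using gr[OF top_closed, of "(j, y)" "(k, z)"] that s_top by (auto simp: rep_sum_def)
  have h_class: "h j = r \<top> `` {g (j, y)}" if j: "j \<in> J" and y: "y \<in> Y j" for j y
  proof
    show "h j \<subseteq> r \<top> `` {g (j, y)}" unfolding h_def using g_top j y by blast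
    show "r \<top> `` {g (j, y)} \<subseteq> h j"
    proof
      fix v assume v: "v \<in> r \<top> `` {g (j, y)}"
      then have "v \<in> X" using rep_closed[OF top_closed] by blast
      then obtain k z where "k \<in> J" "z \<in> Y k" "v = g (k, z)" using gX by blast
      with v j y show "v \<in> h j" using g_top unfolding h_def by blast
    qed
  qed
  have h_comp: "h j \<in> rep_components Q X r" if j: "j \<in> J" for j
  proof -
    obtain y where y: "y \<in> Y j" using ne[OF j] by blast
    then have "g (j, y) \<in> X" using gX j by blast
    then show ?thesis unfolding h_class[OF j y] rep_components_def by (rule quotientI)
  qed
  have "bij_betw h J (rep_components Q X r)"
    unfolding bij_betw_def
  proof
    show "inj_on h J"
    proof (rule inj_onI)
      fix j k assume j: "j \<in> J" and k: "k \<in> J" and eq: "h j = h k"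
      obtain y where y: "y \<in> Y j" using ne[OF j] by blast
      then have "g (j, y) \<in> h k" using eq unfolding h_def by blast
      then obtain z where "z \<in> Y k" "g (j, y) = g (k, z)" unfolding h_def by blast
      then show "j = k" using inj_onD[OF inj, of "(j, y)" "(k, z)"] j k y by simp
    qed
    show "h ` J = rep_components Q X r"
    proof
      show "h ` J \<subseteq> rep_components Q X r" using h_comp by blast
      show "rep_components Q X r \<subseteq> h ` J"
      proof
        fix C assume "C \<in> rep_components Q X r"
        then obtain x where "x \<in> X" and C: "C = r \<top> `` {x}"
          unfolding rep_components_def by (rule quotientE)
        then obtain j y where "j \<in> J" "y \<in> Y j" "x = g (j, y)" using gX by blast
        then show "C \<in> h ` J" unfolding C using h_class by blast
      qed
    qed
  qed
  moreover have "equivalent_reps Q (Y j) (s j) (h j) (restrict_rep r (h j))" if j: "j \<in> J" for j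
  proof -
    have "rep_equivalence Q (Y j) (s j) (h j) (restrict_rep r (h j)) (\<lambda>Z. (\<lambda>y. g (j, y)) ` Z)"
    proof (rule rep_equivalence_image)
      have "inj_on (\<lambda>y. g (j, y)) (Y j)"
        using inj j unfolding inj_on_def by blast
      then show "bij_betw (\<lambda>y. g (j, y)) (Y j) (h j)"
        unfolding h_def by (rule inj_on_imp_bij_betw)
      show "s j a \<subseteq> Y j \<times> Y j" if "a \<in> carrier Q" for a using s_closed[OF j that] .
      show "restrict_rep r (h j) a \<subseteq> h j \<times> h j" for a unfolding restrict_rep_def by blast
      fix a x y assume "a \<in> carrier Q" and x: "x \<in> Y j" and y: "y \<in> Y j"
      then have "(g (j, x), g (j, y)) \<in> r a \<longleftrightarrow> ((j, x), (j, y)) \<in> rep_sum J s a"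
        using gr j by simp
      also have "\<dots> \<longleftrightarrow> (x, y) \<in> s j a" using j by (auto simp: rep_sum_def)
      finally show "(x, y) \<in> s j a \<longleftrightarrow> (g (j, x), g (j, y)) \<in> restrict_rep r (h j) a"
        using x y unfolding restrict_rep_def h_def by blast
    qed
    then show ?thesis unfolding equivalent_reps_def by blast
  qed
  ultimately show ?thesis by blast
qed

section \<open>Algebraic irreducibility and determinism\<close>

text \<open>Determinism says that from \<open>x\<close> every singleton in its class is reachable.
  These are among the subsets that algebraic irreducibility provides, and conversely their unions
  give all subsets, because \<open>r\<close> preserves joins.\<close>

lemma alg_irreducible_iff_deterministic:
  "(\<forall>C \<in> rep_components Q X r. alg_irreducible_rep Q C (restrict_rep r C)) \<longleftrightarrow>
     deterministic_rep Q X r"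
proof
  assume irr: "\<forall>C \<in> rep_components Q X r. alg_irreducible_rep Q C (restrict_rep r C)"
  show "deterministic_rep Q X r"
    unfolding deterministic_rep_def
  proof (intro ballI impI)
    fix x y assume x: "x \<in> X" and "y \<in> X" and xy: "(x, y) \<in> r \<top>"
    let ?C = "r \<top> `` {x}"
    have C: "?C \<in> rep_components Q X r" using x unfolding rep_components_def by (rule quotientI)
    have xC: "x \<in> ?C" using equiv_class_self[OF equiv_rep_top x] .
    have "{y} \<in> Pow ?C" using xy by blast
    also have "Pow ?C = {restrict_rep r ?C a `` {x} | a. a \<in> carrier Q}"
      using bspec[OF irr C] xC by (simp add: alg_irreducible_rep_def)
    finally obtain a where "a \<in> carrier Q" "{y} = restrict_rep r ?C a `` {x}"
      unfolding mem_Collect_eq by (elim exE conjE)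
    then show "\<exists>a \<in> carrier Q. r a `` {x} = {y}"
      using restrict_rep_Image[OF C _ xC] by auto
  qed
next
  assume det: "deterministic_rep Q X r"
  show "\<forall>C \<in> rep_components Q X r. alg_irreducible_rep Q C (restrict_rep r C)"
    unfolding alg_irreducible_rep_def
  proof (intro ballI conjI)
    fix C assume C: "C \<in> rep_components Q X r"
    show "C \<noteq> {}" using irreducible_rep_restrict[OF C] by (simp add: irreducible_rep_def)
    fix x assume x: "x \<in> C"
    show "{restrict_rep r C a `` {x} | a. a \<in> carrier Q} = Pow C"
    proof
      show "{restrict_rep r C a `` {x} | a. a \<in> carrier Q} \<subseteq> Pow C"
        unfolding restrict_rep_def by blast
      show "Pow C \<subseteq> {restrict_rep r C a `` {x} | a. a \<in> carrier Q}"
      proof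
        fix Z assume "Z \<in> Pow C"
        then have "\<exists>a \<in> carrier Q. r a `` {x} = {z}" if "z \<in> Z" for z
          using that det x rep_components_eq_Image[OF C x] rep_components_subset[OF C]
          unfolding deterministic_rep_def by blast
        then obtain a where a: "\<And>z. z \<in> Z \<Longrightarrow> a z \<in> carrier Q \<and> r (a z) `` {x} = {z}"
          by metis
        then have sub: "a ` Z \<subseteq> carrier Q" by blast
        \<comment> \<open>The join of the chosen elements realizes \<open>Z\<close>. For empty
          \<open>Z\<close> it is the empty join, which \<open>r\<close> sends to the empty
          relation.\<close>
        have "r (\<Squnion>(a ` Z)) `` {x} = (\<Union>z\<in>Z. r (a z) `` {x})"
          using rep_sup[OF sub] by auto
        also have "\<dots> = Z" using a by simp
        finally have "restrict_rep r C (\<Squnion>(a ` Z)) `` {x} = Z"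
          using restrict_rep_Image[OF C sup_closed[OF sub] x] by simp
        then show "Z \<in> {restrict_rep r C a `` {x} | a. a \<in> carrier Q}"
          using sup_closed[OF sub] by blast
      qed
    qed
  qed
qed

end

text \<open>The explicit map in the second conjunct expresses that the decomposition is canonical.
  The type variables for indices and points in the uniqueness clause may be instantiated
  freely.\<close>

theorem theorem4p7:
  fixes Q :: "('a, 'm) quantale_scheme"
    and X :: "'x set"
    and r :: "'a \<Rightarrow> ('x \<times> 'x) set"
  assumes "quantale Q"
    and "relational_rep Q X r"
  shows
    "(\<forall>C \<in> rep_components Q X r.
        relational_rep Q C (restrict_rep r C) \<and> irreducible_rep Q C (restrict_rep r C)) \<and>
     rep_equivalence Q X r
       (SIGMA C : rep_components Q X r. C) (rep_sum (rep_components Q X r) (restrict_rep r))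
       (\<lambda>Z. (\<lambda>x. (r \<top>\<^bsub>Q\<^esub> `` {x}, x)) ` Z) \<and>
     (\<forall>(J :: 'j set) (Y :: 'j \<Rightarrow> 'y set) (s :: 'j \<Rightarrow> 'a \<Rightarrow> ('y \<times> 'y) set).
        (\<forall>j \<in> J. relational_rep Q (Y j) (s j) \<and> irreducible_rep Q (Y j) (s j)) \<and>
        equivalent_reps Q X r (Sigma J Y) (rep_sum J s) \<longrightarrow>
        (\<exists>h. bij_betw h J (rep_components Q X r) \<and>
             (\<forall>j \<in> J. equivalent_reps Q (Y j) (s j) (h j) (restrict_rep r (h j))))) \<and>
     ((\<forall>C \<in> rep_components Q X r. alg_irreducible_rep Q C (restrict_rep r C)) \<longleftrightarrow>
        deterministic_rep Q X r)"
proof -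
  interpret relational_representation Q X r
    by (intro relational_representation.intro relational_representation_axioms.intro assms)
  show ?thesis
    by (intro conjI ballI allI impI)
      (simp_all add: relational_rep_restrict irreducible_rep_restrict rep_equivalence_components
        irreducible_decomposition_unique alg_irreducible_iff_deterministic)
qed

end
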